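(* Let $u$ and $v$ satisfy the non-dimensional activator-depleted reaction-diffusion system $$\frac{\partial u}{\partial t}=\triangle_p u+\gamma(\alpha-u+u^2v),\qquad \frac{\partial v}{\partial t}=d\,\triangle_p v+\gamma(\beta-u^2v)$$ with homogeneous Neumann boundary conditions $\frac{\partial u}{\partial r}\big|_{r=\rho}=\frac{\partial v}{\partial r}\big|_{r=\rho}=0$ on a disk-shape domain $\Omega\subset\mathbb{R}^2$ of radius $\rho>0$, with positive real parameters $\gamma,d,\alpha,\beta$. Let $n\in\mathbb{R}\setminus\frac12\mathbb{Z}$ be the associated order of the Bessel equation and let $k$ be any positive integer. For the system to exhibit Hopf or transcritical bifurcation (for the mode $(n,k)$) in the neighbourhood of the unique steady state $(u_s,v_s)=\big(\alpha+\beta,\frac{\beta}{(\alpha+\beta)^2}\big)$, it is necessary that the radius $\rho$ satisfies $$\rho\geq 2\sqrt{\frac{(d+1)(2k+1)(n+2k+1)(n+4k)}{\gamma(n+4k+2)}} .$$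
   Context: $\triangle_p=\frac1r\frac{\partial}{\partial r}\big(r\frac{\partial}{\partial r}\big)+\frac1{r^2}\frac{\partial^2}{\partial\theta^2}$ is the Laplace operator in polar coordinates. For the mode $(n,k)$ one uses the (real) eigenvalue parameter $$\eta_{n,k}^2=\frac{4(2k+1)(n+2k+1)(n+4k)}{\rho^2(n+4k+2)} .$$ Linearising the system about $(u_s,v_s)$ on this mode gives the stability matrix $$\begin{pmatrix}\gamma\frac{\beta-\alpha}{\beta+\alpha}-\eta_{n,k}^2 & \gamma(\beta+\alpha)^2\\[2pt] -\gamma\frac{2\beta}{\beta+\alpha} & -\gamma(\beta+\alpha)^2-d\,\eta_{n,k}^2\end{pmatrix},$$ with eigenvalues $\sigma_1,\sigma_2$. The terminology is the following: the system exhibits Hopf bifurcation (for the mode $(n,k)$ and parameters $\alpha,\beta,\gamma,d,\rho$) if $\sigma_{1,2}\in\mathbb{C}\setminus\mathbb{R}$ with $\mathrm{Re}(\sigma_{1,2})>0$; it exhibits transcritical bifurcation if $\sigma_{1,2}\in\mathbb{C}\setminus\mathbb{R}$ with $\mathrm{Re}(\sigma_{1,2})=0$. *)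

theory Defs
  imports "HOL-Analysis.Analysis" "Jordan_Normal_Form.Spectral_Radius"
begin

definition polar :: "real \<Rightarrow> real \<Rightarrow> real \<times> real" where
  "polar r \<theta> = (r * cos \<theta>, r * sin \<theta>)"

text \<open>
  \<open>has_polar_laplacian w L r \<theta>\<close>: all derivatives in
  \<open>1/r d/dr (r dw/dr) + 1/r^2 d^2w/d\<theta>^2\<close> exist at the point with polar
  coordinates \<open>(r, \<theta>)\<close>, and the value of this expression is \<open>L\<close>. The relational form avoids
  unspecified values of \<open>deriv\<close> at points of non-differentiability.
\<close>

definition has_polar_laplacian ::
  "(real \<times> real \<Rightarrow> real) \<Rightarrow> real \<Rightarrow> real \<Rightarrow> real \<Rightarrow> bool" where
  "has_polar_laplacian w L r \<theta> \<longleftrightarrow>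
     (\<exists>w\<^sub>r w\<^sub>\<theta> D E.
        (\<forall>\<^sub>F s in nhds r. ((\<lambda>x. w (polar x \<theta>)) has_real_derivative w\<^sub>r s) (at s)) \<and>
        ((\<lambda>s. s * w\<^sub>r s) has_real_derivative D) (at r) \<and>
        (\<forall>\<^sub>F \<phi> in nhds \<theta>. ((\<lambda>x. w (polar r x)) has_real_derivative w\<^sub>\<theta> \<phi>) (at \<phi>)) \<and>
        (w\<^sub>\<theta> has_real_derivative E) (at \<theta>) \<and>
        L = 1 / r * D + 1 / r\<^sup>2 * E)"

definition kinetics_u :: "real \<Rightarrow> real \<Rightarrow> real \<Rightarrow> real \<Rightarrow> real" where
  "kinetics_u \<gamma> \<alpha> u v = \<gamma> * (\<alpha> - u + u\<^sup>2 * v)"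

definition kinetics_v :: "real \<Rightarrow> real \<Rightarrow> real \<Rightarrow> real \<Rightarrow> real" where
  "kinetics_v \<gamma> \<beta> u v = \<gamma> * (\<beta> - u\<^sup>2 * v)"

text \<open>
  Classical solutions, for times \<open>t > 0\<close>, on the disk of radius \<open>\<rho>\<close> centred at the origin. The
  equations are imposed where polar coordinates are regular (\<open>0 < r < \<rho>\<close>); continuity on the
  closed disk rules out singularities at the centre. The normal derivative at \<open>r = \<rho>\<close> is
  one-sided.
\<close>

definition rd_solution ::
  "real \<Rightarrow> real \<Rightarrow> real \<Rightarrow> real \<Rightarrow> real \<Rightarrow>
   (real \<times> real \<Rightarrow> real \<Rightarrow> real) \<Rightarrow> (real \<times> real \<Rightarrow> real \<Rightarrow> real) \<Rightarrow> bool" where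
  "rd_solution \<gamma> d \<alpha> \<beta> \<rho> u v \<longleftrightarrow>
     (\<forall>t>0.
        continuous_on (cball 0 \<rho>) (\<lambda>x. u x t) \<and> continuous_on (cball 0 \<rho>) (\<lambda>x. v x t) \<and>
        (\<forall>r \<theta>. 0 < r \<and> r < \<rho> \<longrightarrow>
           (\<exists>L\<^sub>u L\<^sub>v.
              has_polar_laplacian (\<lambda>x. u x t) L\<^sub>u r \<theta> \<and>
              has_polar_laplacian (\<lambda>x. v x t) L\<^sub>v r \<theta> \<and>
              (u (polar r \<theta>) has_real_derivative
                 L\<^sub>u + kinetics_u \<gamma> \<alpha> (u (polar r \<theta>) t) (v (polar r \<theta>) t)) (at t) \<and>
              (v (polar r \<theta>) has_real_derivative
                 d * L\<^sub>v + kinetics_v \<gamma> \<beta> (u (polar r \<theta>) t) (v (polar r \<theta>) t)) (at t))) \<and>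
        (\<forall>\<theta>. ((\<lambda>r. u (polar r \<theta>) t) has_real_derivative 0) (at \<rho> within {0..\<rho>}) \<and>
             ((\<lambda>r. v (polar r \<theta>) t) has_real_derivative 0) (at \<rho> within {0..\<rho>})))"

text \<open>
  The formula for \<open>\<eta>\<^sub>n\<^sub>,\<^sub>k\<^sup>2\<close>; its value may be negative for
  some negative \<open>n\<close>, in which case it is not the square of a real number.
\<close>

definition eta_sq :: "real \<Rightarrow> real \<Rightarrow> nat \<Rightarrow> real" where
  "eta_sq \<rho> n k = 4 * (2 * real k + 1) * (n + 2 * real k + 1) * (n + 4 * real k) /
                    (\<rho>\<^sup>2 * (n + 4 * real k + 2))"

text \<open>
  Linearisation of the system about the uniform state \<open>(u\<^sub>s, v\<^sub>s)\<close>, restricted to a mode on which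
  the Laplacian acts as multiplication by \<open>- e\<close>.
\<close>

definition stability_matrix ::
  "real \<Rightarrow> real \<Rightarrow> real \<Rightarrow> real \<Rightarrow> real \<Rightarrow> real \<Rightarrow> real \<Rightarrow> real mat" where
  "stability_matrix \<gamma> d \<alpha> \<beta> u\<^sub>s v\<^sub>s e = mat_of_rows_list 2
     [[deriv (\<lambda>u. kinetics_u \<gamma> \<alpha> u v\<^sub>s) u\<^sub>s - e, deriv (\<lambda>v. kinetics_u \<gamma> \<alpha> u\<^sub>s v) v\<^sub>s],
      [deriv (\<lambda>u. kinetics_v \<gamma> \<beta> u v\<^sub>s) u\<^sub>s, deriv (\<lambda>v. kinetics_v \<gamma> \<beta> u\<^sub>s v) v\<^sub>s - d * e]]"

definition mode_eigenvalues ::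
  "real \<Rightarrow> real \<Rightarrow> real \<Rightarrow> real \<Rightarrow> real \<Rightarrow> real \<Rightarrow> nat \<Rightarrow> real \<Rightarrow> real \<Rightarrow> complex set" where
  "mode_eigenvalues \<gamma> d \<alpha> \<beta> \<rho> n k u\<^sub>s v\<^sub>s =
     spectrum (map_mat complex_of_real (stability_matrix \<gamma> d \<alpha> \<beta> u\<^sub>s v\<^sub>s (eta_sq \<rho> n k)))"

definition hopf_bifurcation ::
  "real \<Rightarrow> real \<Rightarrow> real \<Rightarrow> real \<Rightarrow> real \<Rightarrow> real \<Rightarrow> nat \<Rightarrow> real \<Rightarrow> real \<Rightarrow> bool" where
  "hopf_bifurcation \<gamma> d \<alpha> \<beta> \<rho> n k u\<^sub>s v\<^sub>s \<longleftrightarrow>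
     (\<exists>\<sigma>\<^sub>1 \<sigma>\<^sub>2. mode_eigenvalues \<gamma> d \<alpha> \<beta> \<rho> n k u\<^sub>s v\<^sub>s = {\<sigma>\<^sub>1, \<sigma>\<^sub>2} \<and>
        \<sigma>\<^sub>1 \<notin> \<real> \<and> \<sigma>\<^sub>2 \<notin> \<real> \<and> Re \<sigma>\<^sub>1 > 0 \<and> Re \<sigma>\<^sub>2 > 0)"

definition transcritical_bifurcation ::
  "real \<Rightarrow> real \<Rightarrow> real \<Rightarrow> real \<Rightarrow> real \<Rightarrow> real \<Rightarrow> nat \<Rightarrow> real \<Rightarrow> real \<Rightarrow> bool" where
  "transcritical_bifurcation \<gamma> d \<alpha> \<beta> \<rho> n k u\<^sub>s v\<^sub>s \<longleftrightarrow>
     (\<exists>\<sigma>\<^sub>1 \<sigma>\<^sub>2. mode_eigenvalues \<gamma> d \<alpha> \<beta> \<rho> n k u\<^sub>s v\<^sub>s = {\<sigma>\<^sub>1, \<sigma>\<^sub>2} \<and>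
        \<sigma>\<^sub>1 \<notin> \<real> \<and> \<sigma>\<^sub>2 \<notin> \<real> \<and> Re \<sigma>\<^sub>1 = 0 \<and> Re \<sigma>\<^sub>2 = 0)"

lemma unique_steady_state:
  assumes "\<gamma> > 0" "\<alpha> > 0" "\<beta> > 0"
  shows "kinetics_u \<gamma> \<alpha> u v = 0 \<and> kinetics_v \<gamma> \<beta> u v = 0 \<longleftrightarrow>
         u = \<alpha> + \<beta> \<and> v = \<beta> / (\<alpha> + \<beta>)\<^sup>2"
proof
  assume "kinetics_u \<gamma> \<alpha> u v = 0 \<and> kinetics_v \<gamma> \<beta> u v = 0"
  then have 1: "\<alpha> - u + u\<^sup>2 * v = 0" and 2: "\<beta> = u\<^sup>2 * v"
    using assms by (auto simp: kinetics_u_def kinetics_v_def)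
  then have u: "u = \<alpha> + \<beta>" by linarith
  then have "u \<noteq> 0" using assms by linarith
  then show "u = \<alpha> + \<beta> \<and> v = \<beta> / (\<alpha> + \<beta>)\<^sup>2"
    using u 2 by (metis nonzero_mult_div_cancel_left power_not_zero)
next
  assume "u = \<alpha> + \<beta> \<and> v = \<beta> / (\<alpha> + \<beta>)\<^sup>2"
  then show "kinetics_u \<gamma> \<alpha> u v = 0 \<and> kinetics_v \<gamma> \<beta> u v = 0"
    using assms by (simp add: kinetics_u_def kinetics_v_def)
qed

lemma steady_state_rd_solution:
  assumes "\<gamma> > 0" "\<alpha> > 0" "\<beta> > 0"
  shows "rd_solution \<gamma> d \<alpha> \<beta> \<rho> (\<lambda>_ _. \<alpha> + \<beta>) (\<lambda>_ _. \<beta> / (\<alpha> + \<beta>)\<^sup>2)"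
proof -
  have L: "has_polar_laplacian (\<lambda>_. c) 0 r \<theta>" for c r \<theta>
    unfolding has_polar_laplacian_def
    by (rule exI[of _ "\<lambda>_. 0"], rule exI[of _ "\<lambda>_. 0"], rule exI[of _ 0], rule exI[of _ 0]) simp
  have kin: "kinetics_u \<gamma> \<alpha> (\<alpha> + \<beta>) (\<beta> / (\<alpha> + \<beta>)\<^sup>2) = 0" "kinetics_v \<gamma> \<beta> (\<alpha> + \<beta>) (\<beta> / (\<alpha> + \<beta>)\<^sup>2) = 0"
    using unique_steady_state[OF assms] by blast+
  then show ?thesis
    unfolding rd_solution_def
  proof (intro allI impI conjI, goal_cases)
    case (3 t r \<theta>)
    show ?case
      by (rule exI[of _ 0], rule exI[of _ 0])
         (simp add: L kin)
  qed simp_all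
qed

lemma stability_matrix_steady_state:
  assumes "\<alpha> > 0" "\<beta> > 0"
  shows "stability_matrix \<gamma> d \<alpha> \<beta> (\<alpha> + \<beta>) (\<beta> / (\<alpha> + \<beta>)\<^sup>2) e = mat_of_rows_list 2
     [[\<gamma> * ((\<beta> - \<alpha>) / (\<beta> + \<alpha>)) - e, \<gamma> * (\<beta> + \<alpha>)\<^sup>2],
      [- \<gamma> * (2 * \<beta> / (\<beta> + \<alpha>)), - \<gamma> * (\<beta> + \<alpha>)\<^sup>2 - d * e]]"
proof -
  have du: "deriv (\<lambda>u. kinetics_u \<gamma> \<alpha> u v) u = \<gamma> * (2 * u * v - 1)" for u v
    unfolding kinetics_u_def by (rule DERIV_imp_deriv) (auto intro!: derivative_eq_intros)
  have dv: "deriv (\<lambda>v. kinetics_u \<gamma> \<alpha> u v) v = \<gamma> * u\<^sup>2" for u v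
    unfolding kinetics_u_def by (rule DERIV_imp_deriv) (auto intro!: derivative_eq_intros)
  have eu: "deriv (\<lambda>u. kinetics_v \<gamma> \<beta> u v) u = - \<gamma> * (2 * u * v)" for u v
    unfolding kinetics_v_def by (rule DERIV_imp_deriv) (auto intro!: derivative_eq_intros)
  have ev: "deriv (\<lambda>v. kinetics_v \<gamma> \<beta> u v) v = - \<gamma> * u\<^sup>2" for u v
    unfolding kinetics_v_def by (rule DERIV_imp_deriv) (auto intro!: derivative_eq_intros)
  have r: "2 * (\<alpha> + \<beta>) * (\<beta> / (\<alpha> + \<beta>)\<^sup>2) = 2 * \<beta> / (\<beta> + \<alpha>)"
  proof -
    have "\<alpha> + \<beta> \<noteq> 0" using assms by simp
    then have "s * (b / s\<^sup>2) = b / s" if "s = \<alpha> + \<beta>" for s b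
      using that by (simp add: power2_eq_square)
    from this[OF refl, of "2 * \<beta>"] show ?thesis
      by (simp only: add.commute[of \<beta> \<alpha>] mult.assoc mult.left_commute times_divide_eq_right)
  qed
  have q: "2 * \<beta> / (\<beta> + \<alpha>) - 1 = (\<beta> - \<alpha>) / (\<beta> + \<alpha>)"
    using assms by (simp add: field_simps)
  have f: "\<gamma> * (2 * (\<alpha> + \<beta>) * (\<beta> / (\<alpha> + \<beta>)\<^sup>2) - 1) = \<gamma> * ((\<beta> - \<alpha>) / (\<beta> + \<alpha>))"
    unfolding r q ..
  show ?thesis
    unfolding stability_matrix_def du dv eu ev f unfolding r by (simp only: add.commute)
qed

end

theory Submission
  imports Defs
begin

text \<open>
  A non-real eigenvalue of a real \<open>2 \<times> 2\<close> matrix has half the trace as its real part, so either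
  bifurcation forces the trace of the stability matrix to be nonnegative:
  \<open>(d + 1) \<eta>\<^sup>2 \<le> \<gamma> ((\<beta> - \<alpha>) / (\<beta> + \<alpha>) - (\<beta> + \<alpha>)\<^sup>2) < \<gamma>\<close>. Since \<open>\<eta>\<^sup>2\<close> is proportional to
  \<open>1 / \<rho>\<^sup>2\<close>, this is a lower bound for \<open>\<rho>\<close>.
\<close>

lemma det_mat_2x2:
  fixes A :: "'a :: comm_ring_1 mat"
  assumes "A \<in> carrier_mat 2 2"
  shows "Determinant.det A = A $$ (0,0) * A $$ (1,1) - A $$ (0,1) * A $$ (1,0)"
proof -
  \<comment> \<open>Deleting row 0 and column \<open>j\<close> leaves a single entry, in row 1 and
    the other column, \<open>1 - j\<close>.\<close>
  have "Determinant.det (mat_delete A 0 j) = A $$ (1, 1 - j)" if "j < 2" for j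
    using assms that
    by (subst det_single) (auto simp: mat_delete_def less_2_cases_iff)
  then show ?thesis
    by (simp add: laplace_expansion_row[OF assms, of 0] cofactor_def numeral_2_eq_2)
qed

text \<open>The characteristic polynomial has real coefficients, so its imaginary part at \<sigma>
  is \<open>Im \<sigma>\<close> times \<open>2 * Re \<sigma> - (a + e)\<close>, and
  \<open>Im \<sigma>\<close> cancels.\<close>

lemma Re_nonreal_eigenvalue_2x2:
  fixes a b c e :: real
  assumes "\<sigma> \<in> spectrum (map_mat complex_of_real (mat_of_rows_list 2 [[a, b], [c, e]]))"
    and "\<sigma> \<notin> \<real>"
  shows "2 * Re \<sigma> = a + e"
proof -
  let ?A = "map_mat complex_of_real (mat_of_rows_list 2 [[a, b], [c, e]])"
  have A: "?A \<in> carrier_mat 2 2"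
    by (auto simp: mat_of_rows_list_def)
  then have "det (char_matrix ?A \<sigma>) = 0"
    using assms(1) by (simp add: spectrum_def eigenvalue_det)
  moreover have "det (char_matrix ?A \<sigma>) = (a - \<sigma>) * (e - \<sigma>) - complex_of_real b * c"
    using A by (subst det_mat_2x2) (auto simp: char_matrix_def mat_of_rows_list_def)
  ultimately have "(a - \<sigma>) * (e - \<sigma>) - complex_of_real b * c = 0"
    by simp
  then have "Im ((a - \<sigma>) * (e - \<sigma>) - complex_of_real b * c) = 0"
    by simp
  then have "Im \<sigma> * (2 * Re \<sigma> - (a + e)) = 0"
    by (simp add: algebra_simps)
  then show ?thesis
    using assms(2) by (simp add: complex_is_Real_iff)
qed

text \<open>Assuming only \<open>Re \<sigma> \<ge> 0\<close> lets one inequality serve both the Hopf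
  and the transcritical case.\<close>

lemma stability_trace_nonneg:
  assumes "\<alpha> > 0" "\<beta> > 0"
    and "\<sigma> \<in> mode_eigenvalues \<gamma> d \<alpha> \<beta> \<rho> n k (\<alpha> + \<beta>) (\<beta> / (\<alpha> + \<beta>)\<^sup>2)"
    and "\<sigma> \<notin> \<real>" "Re \<sigma> \<ge> 0"
  shows "(d + 1) * eta_sq \<rho> n k \<le> \<gamma> * ((\<beta> - \<alpha>) / (\<beta> + \<alpha>) - (\<beta> + \<alpha>)\<^sup>2)"
proof -
  have "2 * Re \<sigma> = \<gamma> * ((\<beta> - \<alpha>) / (\<beta> + \<alpha>)) - eta_sq \<rho> n k
      + (- \<gamma> * (\<beta> + \<alpha>)\<^sup>2 - d * eta_sq \<rho> n k)"
    using assms(3,4)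
    unfolding mode_eigenvalues_def stability_matrix_steady_state[OF assms(1,2)]
    by (rule Re_nonreal_eigenvalue_2x2)
  then show ?thesis
    using assms(5) unfolding ring_distribs by simp
qed

theorem theorem4p1:
  fixes \<gamma> d \<alpha> \<beta> \<rho> n u\<^sub>s v\<^sub>s :: real and k :: nat
    and u v :: "real \<times> real \<Rightarrow> real \<Rightarrow> real"
  assumes "\<gamma> > 0" and "d > 0" and "\<alpha> > 0" and "\<beta> > 0" and "\<rho> > 0"
    and "rd_solution \<gamma> d \<alpha> \<beta> \<rho> u v"
    and "n \<notin> range (\<lambda>m::int. real_of_int m / 2)"
    and "k \<ge> 1"
    and "u\<^sub>s = \<alpha> + \<beta>" and "v\<^sub>s = \<beta> / (\<alpha> + \<beta>)\<^sup>2"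
    and "hopf_bifurcation \<gamma> d \<alpha> \<beta> \<rho> n k u\<^sub>s v\<^sub>s \<or> transcritical_bifurcation \<gamma> d \<alpha> \<beta> \<rho> n k u\<^sub>s v\<^sub>s"
  shows "\<rho> \<ge> 2 * sqrt ((d + 1) * (2 * real k + 1) * (n + 2 * real k + 1) * (n + 4 * real k) /
                         (\<gamma> * (n + 4 * real k + 2)))"
proof -
  define X where "X = (2 * real k + 1) * (n + 2 * real k + 1) * (n + 4 * real k) / (n + 4 * real k + 2)"
  obtain \<sigma> where "\<sigma> \<in> mode_eigenvalues \<gamma> d \<alpha> \<beta> \<rho> n k u\<^sub>s v\<^sub>s" "\<sigma> \<notin> \<real>" "Re \<sigma> \<ge> 0"
    using assms(11) unfolding hopf_bifurcation_def transcritical_bifurcation_def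
    by (metis insertI1 less_imp_le order_refl)
  then have "(d + 1) * eta_sq \<rho> n k \<le> \<gamma> * ((\<beta> - \<alpha>) / (\<beta> + \<alpha>) - (\<beta> + \<alpha>)\<^sup>2)"
    using stability_trace_nonneg[OF assms(3,4)] unfolding assms(9,10) by blast
  \<comment> \<open>Since \<open>(\<beta> - \<alpha>) / (\<beta> + \<alpha>) = 1 - 2 * \<alpha> /
    (\<beta> + \<alpha>)\<close>, dropping the negative terms frees the bound of \<alpha> and
    \<beta>.\<close>
  also have "\<dots> \<le> \<gamma> * 1"
  proof (rule mult_left_mono)
    have "(\<beta> - \<alpha>) / (\<beta> + \<alpha>) \<le> 1"
      using assms(3,4) by simp
    then show "(\<beta> - \<alpha>) / (\<beta> + \<alpha>) - (\<beta> + \<alpha>)\<^sup>2 \<le> 1"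
      by (smt (verit) zero_le_power2)
  qed (use assms(1) in simp)
  \<comment> \<open>The deleted rules would multiply out \<open>4 * (2 * real k + 1)\<close> and
    spoil the match with \<open>X\<close>.\<close>
  also have "eta_sq \<rho> n k = 4 * X / \<rho>\<^sup>2"
    by (simp add: eta_sq_def X_def mult.commute[of "\<rho>\<^sup>2"] mult.assoc
        del: distrib_left_numeral distrib_right_numeral)
  finally have "4 * ((d + 1) * X / \<gamma>) \<le> \<rho>\<^sup>2"
    using assms(1,5) by (simp add: field_simps)
  \<comment> \<open>For some negative \<open>n\<close> the radicand is negative; \<open>sqrt\<close>
    is then negative too, so no case split on the sign of \<open>X\<close> arises.\<close>
  then have "sqrt (4 * ((d + 1) * X / \<gamma>)) \<le> \<rho>"
    using assms(5) by (intro real_le_lsqrt) auto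
  then have "2 * sqrt ((d + 1) * X / \<gamma>) \<le> \<rho>"
    unfolding real_sqrt_mult by simp
  moreover have "(d + 1) * X / \<gamma> = (d + 1) * (2 * real k + 1) * (n + 2 * real k + 1) * (n + 4 * real k) /
      (\<gamma> * (n + 4 * real k + 2))"
    by (simp add: X_def mult.assoc mult.commute[of \<gamma>])
  ultimately show ?thesis
    by simp
qed

end
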